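(* Let $Q\subset\mathbb{R}^{d+1}$ be an open set, $\mathfrak K\subset W^{2,d+1}_{\mathrm{loc}}(Q)$ a convex cone containing the constant function $1$, and $\Sigma\subsetneq\partial_PQ$ an open subset. Let $Lu=-u_t-\operatorname{tr}(aD^2u)-\langle b,Du\rangle+cu$, and assume that for every open subset $U\subset Q$, $L$ has the weak maximum principle property on $U\cup\Sigma$ for $\mathfrak K$. Assume $c\ge0$ a.e. on $Q$. Write $\Gamma:=\partial_PQ\setminus\overline\Sigma$. Let $f\in L^{d+1}_{\mathrm{loc}}(Q)$, $g\in C(\Gamma)$ and $\psi\in C(Q\cup\Gamma)$ with $\psi\le g$ on $\Gamma$. Suppose $u\in\mathfrak K\cap(-\mathfrak K)$ is a solution and $v\in-\mathfrak K$ is a supersolution to the obstacle problem for $f,g,\psi$. (1) If $f\ge0$ a.e. on $Q$, then $v\ge0\wedge\inf_\Gamma g$ on $Q$. (2) If $c\ge c_0$ a.e. on $Q$ for a constant $c_0>0$, then $v\ge0\wedge\frac1{c_0}\operatorname{ess\,inf}_Qf\wedge\inf_\Gamma g$ on $Q$. (3) If $f\le0$ a.e. on $Q$, then $u\le0\vee\sup_\Gamma g\vee\sup_Q\psi$ on $Q$. (4) If $c\ge c_0$ a.e. on $Q$ for a constant $c_0>0$, then $u\le0\vee\frac1{c_0}\operatorname{ess\,sup}_Qf\vee\sup_\Gamma g\vee\sup_Q\psi$ on $Q$. (5) If $u_1,u_2\in\mathfrak K\cap(-\mathfrak K)$ are solutions for $(f_1,g_1,\psi_1)$ and $(f_2,g_2,\psi_2)$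 respectively, with $f_1\ge f_2$ a.e. on $Q$, $\psi_1\ge\psi_2$ on $Q$ and $g_1\ge g_2$ on $\Gamma$, then $u_1\ge u_2$ on $Q$. (6) If $u_i\in\mathfrak K\cap(-\mathfrak K)$ is a solution for $(f_i,g_i,\psi_i)$ with $\psi_i\le g_i$ on $\Gamma$, $i=1,2$, and $c\ge c_0$ a.e. on $Q$ for a constant $c_0>0$, then $$|u_1-u_2|\le\tfrac1{c_0}\|f_1-f_2\|_{L^\infty(Q)}\vee\sup_\Gamma|g_1-g_2|\vee\sup_Q|\psi_1-\psi_2|\quad\text{on }Q,$$ and if $f_1=f_2$ and $c\ge0$ a.e. on $Q$, then $|u_1-u_2|\le\sup_\Gamma|g_1-g_2|\vee\sup_Q|\psi_1-\psi_2|$ on $Q$.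
   Context: Points of $\mathbb{R}^{d+1}$ are $(t,x)$, $t\in\mathbb{R}$, $x\in\mathbb{R}^d$; $D,D^2$ are the gradient and Hessian in $x$ only; $r\vee s=\max\{r,s\}$, $r\wedge s=\min\{r,s\}$; suprema and infima may be infinite. The coefficients $a$ (values in non-negative definite symmetric $d\times d$ matrices), $b$ ($\mathbb{R}^d$-valued), $c$ (real-valued) are measurable and defined a.e. on $Q$. For an open set $U\subset\mathbb{R}^{d+1}$ with topological boundary $\partial U$, the parabolic boundary (terminal-value convention) is $\partial_PU:=\{(t^0,x^0)\in\partial U:\ \{(t,x):|x-x^0|<\varepsilon,\ t^0-\varepsilon^2<t<t^0\}\cap U\neq\emptyset\ \ \forall\,\varepsilon>0\}$. $\overline\Sigma$ is the closure of $\Sigma$ in $\partial Q$. $W^{2,p}_{\mathrm{loc}}(Q)$ is the set of measurable $u$ such that $u$ and its weak derivatives $u_t,u_{x_i},u_{x_ix_j}$ belong to $L^p_{\mathrm{loc}}(Q)$; elements of $W^{2,d+1}_{\mathrm{loc}}(Q)$ are identified with their continuous representatives. A convex cone $\mathfrak K$ satisfies $\alpha u+\beta v\in\mathfrak K$ whenever $u,v\in\mathfrak K$ and $\alpha,\beta\ge0$. Weak maximum principle property on $U\cup\Sigma$ for $\mathfrak K$, where $U\subset Q$ is open: whenever $w\in\mathfrak K$ satisfies $Lw\le0$ a.e. on $U$ and the upper semicontinuous envelope (limsup from $U$) of $w|_U$ is $\le0$ on $\partial_PU\setminus\overline\Sigma$, then $w\le0$ on $U$. A solution (respectively, supersolution)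 to the obstacle problem for $f,g,\psi$ is a function $u\in W^{2,d+1}_{\mathrm{loc}}(Q)$, extending continuously to $Q\cup\Gamma$, with $\min\{Lu-f,\ u-\psi\}=0$ (respectively, $\ge0$) a.e. on $Q$ and $u=g$ (respectively, $u\ge g$) on $\Gamma$. The data $f_i,g_i,\psi_i$ in (5), (6) belong to the same spaces as $f,g,\psi$, with $\psi_i\le g_i$ on $\Gamma$.
   Formalization: In (1)–(4) and (6) the cone K is assumed to contain the constant −1 as well as 1; with only 1 in K these bounds can fail. Item (5) is stated and proved with 1 in K alone. *)

theory Defs
  imports "HOL-Analysis.Analysis" "HOL-Probability.Essential_Supremum"
begin

definition parabolic_boundary ::
    "(real \<times> 'a::euclidean_space) set \<Rightarrow> (real \<times> 'a) set" where
  "parabolic_boundary U = {z \<in> frontier U. \<forall>\<epsilon>>0.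
     {y. norm (snd y - snd z) < \<epsilon> \<and> fst z - \<epsilon>\<^sup>2 < fst y \<and> fst y < fst z} \<inter> U \<noteq> {}}"

definition Lp_loc :: "nat \<Rightarrow> 'a::euclidean_space set \<Rightarrow> ('a \<Rightarrow> real) set" where
  "Lp_loc p Q = {u \<in> borel_measurable (lebesgue_on Q).
     \<forall>C. compact C \<and> C \<subseteq> Q \<longrightarrow> set_integrable lebesgue C (\<lambda>z. \<bar>u z\<bar> ^ p)}"

primrec iterated_deriv ::
    "'a::euclidean_space list \<Rightarrow> ('a \<Rightarrow> real) \<Rightarrow> 'a \<Rightarrow> real" where
  "iterated_deriv [] \<phi> = \<phi>"
| "iterated_deriv (e # es) \<phi> = (\<lambda>z. frechet_derivative (iterated_deriv es \<phi>) (at z) e)"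

text \<open>The first clause says that \<open>\<phi>\<close> is of class \<open>C\<^sup>\<infinity>\<close>: all iterated directional derivatives
  are differentiable, in particular continuous.\<close>

definition test_function :: "'a::euclidean_space set \<Rightarrow> ('a \<Rightarrow> real) \<Rightarrow> bool" where
  "test_function Q \<phi> \<longleftrightarrow>
     (\<forall>es z. iterated_deriv es \<phi> differentiable (at z)) \<and>
     (\<exists>C. compact C \<and> C \<subseteq> Q \<and> (\<forall>z. z \<notin> C \<longrightarrow> \<phi> z = 0))"

text \<open>\<open>v\<close> is a version of the weak derivative of \<open>u\<close> on \<open>Q\<close> along the list of directions \<open>es\<close>;
  on an open \<open>Q\<close> it is unique up to null sets.\<close>

definition has_weak_deriv ::
    "'a::euclidean_space set \<Rightarrow> ('a \<Rightarrow> real) \<Rightarrow> 'a list \<Rightarrow> ('a \<Rightarrow> real) \<Rightarrow> bool" where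
  "has_weak_deriv Q u es v \<longleftrightarrow> u \<in> Lp_loc 1 Q \<and> v \<in> Lp_loc 1 Q \<and>
     (\<forall>\<phi>. test_function Q \<phi> \<longrightarrow>
        (LINT z:Q|lebesgue. u z * iterated_deriv es \<phi> z) =
        (-1) ^ length es * (LINT z:Q|lebesgue. v z * \<phi> z))"

abbreviation dir_t :: "real \<times> (real^'n)" where
  "dir_t \<equiv> (1, 0)"

abbreviation dir_x :: "'n \<Rightarrow> real \<times> (real^'n)" where
  "dir_x i \<equiv> (0, axis i 1)"

text \<open>The elements are the continuous representatives. Functions are total, but membership only
  depends on the values on \<open>Q\<close>.\<close>

definition W2_loc ::
    "nat \<Rightarrow> (real \<times> (real^'n)) set \<Rightarrow> (real \<times> (real^'n) \<Rightarrow> real) set" where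
  "W2_loc p Q = {u \<in> Lp_loc p Q. continuous_on Q u \<and>
     (\<exists>v\<in>Lp_loc p Q. has_weak_deriv Q u [dir_t] v) \<and>
     (\<forall>i. \<exists>v\<in>Lp_loc p Q. has_weak_deriv Q u [dir_x i] v) \<and>
     (\<forall>i j. \<exists>v\<in>Lp_loc p Q. has_weak_deriv Q u [dir_x i, dir_x j] v)}"

text \<open>\<open>h\<close> is a version of \<open>L u = - u\<^sub>t - tr (a D\<^sup>2 u) - \<langle>b, D u\<rangle> + c u\<close> on \<open>Q\<close>. Two versions agree
  almost everywhere on \<open>Q\<close>, as weak derivatives do, so that a statement about \<open>L u\<close> holding almost
  everywhere may be read off from any of them.\<close>

definition is_parabolic_op ::
    "(real \<times> (real^'n)) set \<Rightarrow> (real \<times> (real^'n) \<Rightarrow> real^'n^'n) \<Rightarrow>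
     (real \<times> (real^'n) \<Rightarrow> real^'n) \<Rightarrow> (real \<times> (real^'n) \<Rightarrow> real) \<Rightarrow>
     (real \<times> (real^'n) \<Rightarrow> real) \<Rightarrow> (real \<times> (real^'n) \<Rightarrow> real) \<Rightarrow> bool" where
  "is_parabolic_op Q a b c u h \<longleftrightarrow> (\<exists>ut Du D2u.
     has_weak_deriv Q u [dir_t] ut \<and>
     (\<forall>i. has_weak_deriv Q u [dir_x i] (\<lambda>z. Du z $ i)) \<and>
     (\<forall>i j. has_weak_deriv Q u [dir_x i, dir_x j] (\<lambda>z. D2u z $ i $ j)) \<and>
     h = (\<lambda>z. - ut z - trace (a z ** D2u z) - b z \<bullet> Du z + c z * u z))"

definition convex_cone_fun :: "('a \<Rightarrow> real) set \<Rightarrow> bool" where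
  "convex_cone_fun K \<longleftrightarrow>
     (\<forall>u\<in>K. \<forall>v\<in>K. \<forall>\<alpha>\<ge>0. \<forall>\<beta>\<ge>0. (\<lambda>z. \<alpha> * u z + \<beta> * v z) \<in> K)"

definition neg_cone :: "('a \<Rightarrow> real) set \<Rightarrow> ('a \<Rightarrow> real) set" where
  "neg_cone K = {u. (\<lambda>z. - u z) \<in> K}"

text \<open>\<open>T\<close> is the exempted part of the boundary (the closure of \<open>\<Sigma>\<close>). The \<open>Limsup\<close> is taken from
  within \<open>U\<close>, in the extended reals.\<close>

definition weak_max_principle ::
    "(real \<times> (real^'n)) set \<Rightarrow> (real \<times> (real^'n) \<Rightarrow> real^'n^'n) \<Rightarrow>
     (real \<times> (real^'n) \<Rightarrow> real^'n) \<Rightarrow> (real \<times> (real^'n) \<Rightarrow> real) \<Rightarrow>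
     (real \<times> (real^'n) \<Rightarrow> real) set \<Rightarrow> (real \<times> (real^'n)) set \<Rightarrow>
     (real \<times> (real^'n)) set \<Rightarrow> bool" where
  "weak_max_principle Q a b c K T U \<longleftrightarrow> (\<forall>w\<in>K.
     (\<exists>h. is_parabolic_op Q a b c w h \<and> (AE z in lebesgue_on U. h z \<le> 0)) \<and>
     (\<forall>z \<in> parabolic_boundary U - T. Limsup (at z within U) (\<lambda>y. ereal (w y)) \<le> 0)
     \<longrightarrow> (\<forall>z\<in>U. w z \<le> 0))"

definition obstacle_data ::
    "(real \<times> (real^'n)) set \<Rightarrow> (real \<times> (real^'n)) set \<Rightarrow> (real \<times> (real^'n) \<Rightarrow> real) \<Rightarrow>
     (real \<times> (real^'n) \<Rightarrow> real) \<Rightarrow> (real \<times> (real^'n) \<Rightarrow> real) \<Rightarrow> bool" where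
  "obstacle_data Q \<Gamma> f g \<psi> \<longleftrightarrow>
     f \<in> Lp_loc (CARD('n) + 1) Q \<and> continuous_on \<Gamma> g \<and> continuous_on (Q \<union> \<Gamma>) \<psi> \<and>
     (\<forall>z\<in>\<Gamma>. \<psi> z \<le> g z)"

definition obstacle_solution ::
    "(real \<times> (real^'n)) set \<Rightarrow> (real \<times> (real^'n)) set \<Rightarrow> (real \<times> (real^'n) \<Rightarrow> real^'n^'n) \<Rightarrow>
     (real \<times> (real^'n) \<Rightarrow> real^'n) \<Rightarrow> (real \<times> (real^'n) \<Rightarrow> real) \<Rightarrow>
     (real \<times> (real^'n) \<Rightarrow> real) \<Rightarrow> (real \<times> (real^'n) \<Rightarrow> real) \<Rightarrow>
     (real \<times> (real^'n) \<Rightarrow> real) \<Rightarrow> (real \<times> (real^'n) \<Rightarrow> real) \<Rightarrow> bool" where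
  "obstacle_solution Q \<Gamma> a b c f g \<psi> u \<longleftrightarrow> u \<in> W2_loc (CARD('n) + 1) Q \<and>
     (\<exists>u'. continuous_on (Q \<union> \<Gamma>) u' \<and> (\<forall>z\<in>Q. u' z = u z) \<and> (\<forall>z\<in>\<Gamma>. u' z = g z)) \<and>
     (\<exists>h. is_parabolic_op Q a b c u h \<and>
        (AE z in lebesgue_on Q. min (h z - f z) (u z - \<psi> z) = 0))"

definition obstacle_supersolution ::
    "(real \<times> (real^'n)) set \<Rightarrow> (real \<times> (real^'n)) set \<Rightarrow> (real \<times> (real^'n) \<Rightarrow> real^'n^'n) \<Rightarrow>
     (real \<times> (real^'n) \<Rightarrow> real^'n) \<Rightarrow> (real \<times> (real^'n) \<Rightarrow> real) \<Rightarrow>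
     (real \<times> (real^'n) \<Rightarrow> real) \<Rightarrow> (real \<times> (real^'n) \<Rightarrow> real) \<Rightarrow>
     (real \<times> (real^'n) \<Rightarrow> real) \<Rightarrow> (real \<times> (real^'n) \<Rightarrow> real) \<Rightarrow> bool" where
  "obstacle_supersolution Q \<Gamma> a b c f g \<psi> u \<longleftrightarrow> u \<in> W2_loc (CARD('n) + 1) Q \<and>
     (\<exists>u'. continuous_on (Q \<union> \<Gamma>) u' \<and> (\<forall>z\<in>Q. u' z = u z) \<and> (\<forall>z\<in>\<Gamma>. u' z \<ge> g z)) \<and>
     (\<exists>h. is_parabolic_op Q a b c u h \<and>
        (AE z in lebesgue_on Q. min (h z - f z) (u z - \<psi> z) \<ge> 0))"

abbreviation ess_sup_on :: "'a::euclidean_space set \<Rightarrow> ('a \<Rightarrow> real) \<Rightarrow> ereal" where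
  "ess_sup_on Q f \<equiv> esssup (lebesgue_on Q) (\<lambda>z. ereal (f z))"

abbreviation ess_inf_on :: "'a::euclidean_space set \<Rightarrow> ('a \<Rightarrow> real) \<Rightarrow> ereal" where
  "ess_inf_on Q f \<equiv> - esssup (lebesgue_on Q) (\<lambda>z. ereal (- f z))"

text \<open>The theorem compares functions with constants by applying the maximum principle to
  \<open>u - m\<close>, where \<open>m \<ge> 0\<close>. This needs the constant \<open>-1\<close> in the cone \<open>K\<close>, not only \<open>1\<close>, hence the
  premise \<open>(\<lambda>_. -1) \<in> K\<close> on the bounds by constants. With \<open>1 \<in> K\<close> alone they fail: let \<open>d = 1\<close>,
  \<open>Q = (0,1) \<times> \<real>\<close>, \<open>\<Sigma> = {}\<close>, \<open>a = c = 0\<close>, \<open>b (t,x) = 1 / (1 - t)\<close>, \<open>p (t,x) = 1 + (1 - t) exp x\<close>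
  and \<open>K = {\<alpha> p + \<beta> | \<alpha> \<in> \<real>, \<beta> \<ge> 0}\<close>. Then \<open>L w = 0\<close> for every \<open>w\<close> in \<open>K\<close>, and \<open>L\<close> has the weak maximum
  principle property for \<open>K\<close> on all open subsets of \<open>Q\<close>: if \<open>\<alpha> \<ge> 0\<close>, then \<open>w \<ge> \<alpha> + \<beta>\<close>, and
  if \<open>\<alpha> < 0\<close>, then \<open>w\<close> increases in \<open>t\<close>. But \<open>p\<close> solves the obstacle problem for \<open>f = 0\<close>,
  \<open>g = 1\<close>, \<open>\<psi> = 0\<close> and is unbounded.\<close>

end

theory Submission
  imports Defs
begin

text \<open>All six assertions are instances of one comparison: if \<open>u\<close> is a subsolution for
  \<open>(f\<^sub>2, g\<^sub>2, \<psi>\<^sub>2)\<close>, \<open>v\<close> is a supersolution for \<open>(f\<^sub>1, g\<^sub>1, \<psi>\<^sub>1)\<close> and \<open>m \<ge> 0\<close> is a constant with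
  \<open>f\<^sub>2 \<le> f\<^sub>1 + c m\<close>, \<open>\<psi>\<^sub>2 \<le> \<psi>\<^sub>1 + m\<close> and \<open>g\<^sub>2 \<le> g\<^sub>1 + m\<close>, then \<open>u \<le> v + m\<close>
  (\<open>obstacle_comparison\<close>). The reason is that on the open set \<open>U = {u > v + m}\<close> the function \<open>u\<close>
  lies above its own obstacle, so that \<open>L u \<le> f\<^sub>2\<close> there and \<open>w = u - v - m\<close> satisfies \<open>L w \<le> 0\<close>
  on \<open>U\<close>. As \<open>w\<close> has nonpositive limits on the part of the parabolic boundary of \<open>U\<close> that matters,
  the weak maximum principle on \<open>U\<close> forces \<open>U\<close> to be empty (\<open>nonpos_if_Lw_nonpos_where_pos\<close>).

  A bound by a constant is the comparison of a solution with the function \<open>0\<close>. It solves the problem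
  with zero data, and it is a subsolution for every obstacle: bounds from above take \<open>v = 0\<close>, bounds
  from below take \<open>u = 0\<close>. The constant \<open>m\<close> is the absolute value of the bound, and
  \<open>c \<ge> c\<^sub>0\<close> turns the essential bounds of \<open>f / c\<^sub>0\<close> into bounds of \<open>f\<close> by \<open>c m\<close>. The estimates of
  \<open>\<bar>u\<^sub>1 - u\<^sub>2\<bar>\<close> compare the two solutions in both orders, and monotonicity is the case \<open>m = 0\<close>.

  The formula \<open>L (u - v - m) = L u - L v - c m\<close> rests on the linearity of weak derivatives and on the
  fact that constants have weak derivatives zero, that is, derivatives of test functions have
  integral zero.\<close>

section \<open>Integration by parts against constants\<close>

lemma iterated_deriv_append:
  "iterated_deriv (es @ es') \<phi> = iterated_deriv es (iterated_deriv es' \<phi>)"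
  by (induction es) auto

lemma iterated_deriv_eq_0_outside:
  assumes "closed C" and "\<And>z. z \<notin> C \<Longrightarrow> \<phi> z = 0" and "z \<notin> C"
  shows "iterated_deriv es \<phi> z = 0"
  using \<open>z \<notin> C\<close>
proof (induction es arbitrary: z)
  case (Cons e es)
  have "(iterated_deriv es \<phi> has_derivative (\<lambda>_. 0)) (at z)"
    by (rule has_derivative_transform_within_open[where f = "\<lambda>_. 0" and s = "- C"])
      (use Cons assms in auto)
  then show ?case
    by (simp add: frechet_derivative_at[symmetric])
qed (use assms in simp)

lemma test_function_iterated_deriv:
  assumes "test_function Q \<phi>"
  shows "test_function Q (iterated_deriv es \<phi>)"
proof -
  from assms obtain C where C: "compact C" "C \<subseteq> Q" "\<And>z. z \<notin> C \<Longrightarrow> \<phi> z = 0"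
    unfolding test_function_def by blast
  then have "\<And>z. z \<notin> C \<Longrightarrow> iterated_deriv es \<phi> z = 0"
    by (intro iterated_deriv_eq_0_outside[of C]) (auto simp: compact_imp_closed)
  with assms C(1,2) show ?thesis
    unfolding test_function_def iterated_deriv_append[symmetric] by blast
qed

lemma test_function_continuous:
  assumes "test_function Q \<phi>"
  shows "continuous_on UNIV \<phi>"
proof -
  have "\<phi> differentiable (at z)" for z
    using assms unfolding test_function_def by (metis iterated_deriv.simps(1))
  then show ?thesis
    by (simp add: continuous_at_imp_continuous_on differentiable_imp_continuous_within)
qed

lemma bounded_if_compact_support:
  fixes F :: "'a::euclidean_space \<Rightarrow> real"
  assumes "continuous_on UNIV F" and "compact C" and "\<And>z. z \<notin> C \<Longrightarrow> F z = 0"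
  obtains B where "B \<ge> 0" and "\<And>z. \<bar>F z\<bar> \<le> B"
proof -
  have "compact (F ` C)"
    using assms by (meson compact_continuous_image continuous_on_subset subset_UNIV)
  then obtain B where "\<And>y. y \<in> F ` C \<Longrightarrow> \<bar>y\<bar> \<le> B"
    by (metis bounded_real compact_imp_bounded)
  then have "\<bar>F z\<bar> \<le> max 0 B" for z
    using assms(3)[of z] by (cases "z \<in> C") (force simp: max_def)+
  then show ?thesis
    by (intro that[of "max 0 B"]) auto
qed

text \<open>By translation invariance all difference quotients of \<open>F\<close> have integral zero. They are
  bounded by the mean value theorem, vanish outside a common compact set and converge to the
  derivative, so its integral is zero by dominated convergence.\<close>

lemma integral_directional_derivative_eq_0:
  fixes F :: "'a::euclidean_space \<Rightarrow> real" and e :: 'a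
  defines "G \<equiv> \<lambda>z. frechet_derivative F (at z) e"
  assumes diff: "\<And>z. F differentiable (at z)"
    and contG: "continuous_on UNIV G"
    and C: "compact C" "\<And>z. z \<notin> C \<Longrightarrow> F z = 0"
  shows "(LINT z|lebesgue. G z) = 0"
proof -
  have contF: "continuous_on UNIV F"
    using diff by (simp add: continuous_at_imp_continuous_on differentiable_imp_continuous_within)
  have [measurable]: "F \<in> borel_measurable borel" "G \<in> borel_measurable borel"
    using contF contG by (auto intro: borel_measurable_continuous_onI)
  have G0: "G z = 0" if "z \<notin> C" for z
    using iterated_deriv_eq_0_outside[of C F z "[e]"] that C unfolding G_def
    by (auto simp: compact_imp_closed)
  obtain B where B: "B \<ge> 0" "\<And>z. \<bar>G z\<bar> \<le> B"
    using bounded_if_compact_support[OF contG C(1) G0] by auto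
  have derF: "((\<lambda>s. F (z + s *\<^sub>R e)) has_real_derivative G (z + s *\<^sub>R e)) (at s)" for z s
  proof -
    have "(F has_derivative frechet_derivative F (at (z + s *\<^sub>R e))) (at (z + s *\<^sub>R e))"
      using diff frechet_derivative_works by blast
    then have D: "((\<lambda>s. F (z + s *\<^sub>R e)) has_derivative
        (\<lambda>t. frechet_derivative F (at (z + s *\<^sub>R e)) (t *\<^sub>R e))) (at s)"
      by (auto intro!: has_derivative_compose[where f = "\<lambda>s. z + s *\<^sub>R e" and g = F]
          derivative_eq_intros)
    have "linear (frechet_derivative F (at (z + s *\<^sub>R e)))"
      using diff by (simp add: linear_frechet_derivative)
    with D show ?thesis
      unfolding has_field_derivative_def G_def
      by (simp add: linear_scale mult.commute[of _ "frechet_derivative _ _ _"])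
  qed
  define s :: "nat \<Rightarrow> real" where "s n = inverse (real (Suc n))" for n
  have s: "s n > 0" "s n \<le> 1" for n
    by (auto simp: s_def inverse_eq_divide)
  define q where "q n z = (F (z + s n *\<^sub>R e) - F z) / s n" for n z
  define C' where "C' = {x - y | x y. x \<in> C \<and> y \<in> (\<lambda>r. r *\<^sub>R e) ` {0..1}}"
  have "compact C'"
    unfolding C'_def
    by (intro compact_differences C compact_continuous_image continuous_intros compact_Icc)
  have q_le: "\<bar>q n z\<bar> \<le> B * indicator C' z" for n z
  proof -
    obtain r where r: "0 < r" "r < s n" "F (z + s n *\<^sub>R e) - F z = s n * G (z + r *\<^sub>R e)"
      using MVT2[of 0 "s n" "\<lambda>s. F (z + s *\<^sub>R e)" "\<lambda>s. G (z + s *\<^sub>R e)"] derF s(1)[of n] by auto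
    then have q: "q n z = G (z + r *\<^sub>R e)"
      using s(1)[of n] by (simp add: q_def)
    show ?thesis
    proof (cases "z + r *\<^sub>R e \<in> C")
      case True
      moreover have "r \<in> {0..1}"
        using r s(2)[of n] by auto
      ultimately have "(z + r *\<^sub>R e) - r *\<^sub>R e \<in> C'"
        unfolding C'_def by blast
      with B(2)[of "z + r *\<^sub>R e"] q show ?thesis
        by simp
    next
      case False
      with G0 q B(1) show ?thesis
        by simp
    qed
  qed
  have s_lim: "s \<longlonglongrightarrow> 0"
    unfolding s_def by (rule LIMSEQ_inverse_real_of_nat)
  have q_lim: "(\<lambda>n. q n z) \<longlonglongrightarrow> G z" for z
  proof -
    have "((\<lambda>h. (F (z + h *\<^sub>R e) - F z) / h) \<longlongrightarrow> G z) (at 0)"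
      using derF[of z 0] by (simp add: DERIV_def)
    moreover have "filterlim s (at 0) sequentially"
      using s_lim s(1) by (auto simp: filterlim_at intro!: always_eventually less_imp_neq[symmetric])
    ultimately show ?thesis
      unfolding q_def by (rule filterlim_compose)
  qed
  have C'_emeasure: "emeasure lborel C' < \<infinity>"
    using \<open>compact C'\<close> by (rule emeasure_compact_finite)
  have C'_sets [measurable]: "C' \<in> sets borel"
    using \<open>compact C'\<close> by (simp add: borel_compact)
  have q_int: "(LINT z|lborel. q n z) = 0" for n
  proof -
    obtain B' where B': "B' \<ge> 0" "\<And>z. \<bar>F z\<bar> \<le> B'"
      using bounded_if_compact_support[OF contF C] by auto
    have [measurable]: "C \<in> sets borel"
      using C(1) by (simp add: borel_compact)
    have F_int: "integrable lborel F"
    proof (rule Bochner_Integration.integrable_bound)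
      show "integrable lborel (\<lambda>z. B' * indicator C z)"
        using emeasure_compact_finite[OF C(1)]
        by (intro integrable_mult_right integrable_real_indicator) auto
      show "AE z in lborel. norm (F z) \<le> norm (B' * indicator C z)"
        using B' C(2) by (auto simp: indicator_def)
    qed simp
    have sh: "(LINT z|lborel. F (z + s n *\<^sub>R e)) = (LINT z|lborel. F z)"
      "integrable lborel (\<lambda>z. F (z + s n *\<^sub>R e))"
      using integral_distr[of "(+) (s n *\<^sub>R e)" lborel borel F]
        integrable_distr_eq[of "(+) (s n *\<^sub>R e)" lborel borel F] F_int
      by (simp_all add: lborel_distr_plus add.commute)
    show ?thesis
      unfolding q_def using sh F_int by simp
  qed
  have "(\<lambda>n. LINT z|lborel. q n z) \<longlonglongrightarrow> (LINT z|lborel. G z)"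
  proof (rule integral_dominated_convergence[where w = "\<lambda>z. B * indicator C' z"])
    show "integrable lborel (\<lambda>z. B * indicator C' z)"
      using C'_emeasure by (auto intro!: integrable_mult_right integrable_real_indicator)
    show "q n \<in> borel_measurable lborel" for n
      unfolding q_def by measurable
  qed (use q_le q_lim in auto)
  then have "(LINT z|lborel. G z) = 0"
    by (simp add: q_int LIMSEQ_const_iff)
  then show ?thesis
    by (simp add: integral_completion)
qed

lemma integral_iterated_deriv_eq_0:
  assumes "test_function Q \<phi>" and "es \<noteq> []"
  shows "(LINT z:Q|lebesgue. iterated_deriv es \<phi> z) = 0"
proof -
  obtain e es' where es: "es = e # es'"
    using assms(2) by (cases es) auto
  obtain C where C: "compact C" "C \<subseteq> Q" "\<And>z. z \<notin> C \<Longrightarrow> \<phi> z = 0"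
    using assms(1) unfolding test_function_def by blast
  have zero: "iterated_deriv fs \<phi> z = 0" if "z \<notin> C" for fs z
    using iterated_deriv_eq_0_outside[of C \<phi> z fs] C that by (auto simp: compact_imp_closed)
  have "(LINT z:Q|lebesgue. iterated_deriv es \<phi> z) = (LINT z|lebesgue. iterated_deriv es \<phi> z)"
    unfolding set_lebesgue_integral_def
    by (intro Bochner_Integration.integral_cong) (use zero C in \<open>auto simp: indicator_def\<close>)
  also have "\<dots> = 0"
    unfolding es iterated_deriv.simps
  proof (rule integral_directional_derivative_eq_0[where C = C])
    show "iterated_deriv es' \<phi> differentiable at z" for z
      using assms(1) unfolding test_function_def by blast
    show "continuous_on UNIV (\<lambda>z. frechet_derivative (iterated_deriv es' \<phi>) (at z) e)"
      using test_function_continuous[OF test_function_iterated_deriv[OF assms(1), of "e # es'"]]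
      by simp
  qed (use zero C in auto)
  finally show ?thesis .
qed

section \<open>Linearity of weak derivatives and of the operator\<close>

lemma Lp_loc_1_lincomb:
  assumes "u \<in> Lp_loc 1 Q" and "v \<in> Lp_loc 1 Q"
  shows "(\<lambda>z. \<alpha> * u z + \<beta> * v z) \<in> Lp_loc 1 Q"
proof -
  have [measurable]: "u \<in> borel_measurable (lebesgue_on Q)" "v \<in> borel_measurable (lebesgue_on Q)"
    using assms by (auto simp: Lp_loc_def)
  have "set_integrable lebesgue C (\<lambda>z. \<bar>\<alpha> * u z + \<beta> * v z\<bar>)" if C: "compact C" "C \<subseteq> Q" for C
  proof -
    have int: "integrable (lebesgue_on C) (\<lambda>z. \<bar>u z\<bar>)" "integrable (lebesgue_on C) (\<lambda>z. \<bar>v z\<bar>)"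
      using assms C by (auto simp: Lp_loc_def set_integrable_def integrable_restrict_space
          lmeasurable_compact fmeasurableD)
    have [measurable]: "u \<in> borel_measurable (lebesgue_on C)" "v \<in> borel_measurable (lebesgue_on C)"
      using C(2) assms by (force simp: Lp_loc_def intro: measurable_restrict_mono[of _ _ Q])+
    have "integrable (lebesgue_on C) (\<lambda>z. \<bar>\<alpha> * u z + \<beta> * v z\<bar>)"
    proof (rule Bochner_Integration.integrable_bound)
      show "integrable (lebesgue_on C) (\<lambda>z. \<bar>\<alpha>\<bar> * \<bar>u z\<bar> + \<bar>\<beta>\<bar> * \<bar>v z\<bar>)"
        using int by simp
      show "AE z in lebesgue_on C. norm \<bar>\<alpha> * u z + \<beta> * v z\<bar> \<le> norm (\<bar>\<alpha>\<bar> * \<bar>u z\<bar> + \<bar>\<beta>\<bar> * \<bar>v z\<bar>)"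
        by (auto simp flip: abs_mult intro: order_trans[OF abs_triangle_ineq])
    qed measurable
    then show ?thesis
      using C by (simp add: set_integrable_def integrable_restrict_space
          lmeasurable_compact fmeasurableD)
  qed
  then show ?thesis
    by (auto simp: Lp_loc_def)
qed

lemma set_integrable_Lp_loc_1_mult_test_function:
  assumes "open Q" and "u \<in> Lp_loc 1 Q" and "test_function Q \<phi>"
  shows "set_integrable lebesgue Q (\<lambda>z. u z * \<phi> z)"
proof -
  obtain C where C: "compact C" "C \<subseteq> Q" "\<And>z. z \<notin> C \<Longrightarrow> \<phi> z = 0"
    using assms(3) unfolding test_function_def by blast
  have cont: "continuous_on UNIV \<phi>"
    using assms(3) by (rule test_function_continuous)
  obtain B where B: "B \<ge> 0" "\<And>z. \<bar>\<phi> z\<bar> \<le> B"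
    using bounded_if_compact_support[OF cont C(1,3)] by auto
  have [measurable]: "\<phi> \<in> borel_measurable lebesgue"
    using cont by (intro measurable_completion) (simp add: borel_measurable_continuous_onI)
  have Q: "Q \<in> sets lebesgue"
    using assms(1) by simp
  have [measurable]: "(\<lambda>z. indicator Q z *\<^sub>R u z) \<in> borel_measurable lebesgue"
    using assms(2) Q by (subst borel_measurable_restrict_space_iff[symmetric]) (auto simp: Lp_loc_def)
  have meas: "(\<lambda>z. (indicator Q z *\<^sub>R u z) * \<phi> z) \<in> borel_measurable lebesgue"
    by measurable
  have "integrable lebesgue (\<lambda>z. B * (indicator C z *\<^sub>R \<bar>u z\<bar>))"
    using assms(2) C by (auto simp: Lp_loc_def set_integrable_def)
  then show ?thesis
    unfolding set_integrable_def
  proof (rule Bochner_Integration.integrable_bound)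
    show "(\<lambda>z. indicator Q z *\<^sub>R (u z * \<phi> z)) \<in> borel_measurable lebesgue"
      using meas by (simp add: mult.assoc)
    show "AE z in lebesgue. norm (indicator Q z *\<^sub>R (u z * \<phi> z)) \<le> norm (B * (indicator C z *\<^sub>R \<bar>u z\<bar>))"
    proof (rule AE_I2)
      fix z
      show "norm (indicator Q z *\<^sub>R (u z * \<phi> z)) \<le> norm (B * (indicator C z *\<^sub>R \<bar>u z\<bar>))"
        using C(2) C(3)[of z] B mult_left_mono[OF B(2)[of z], of "\<bar>u z\<bar>"]
        by (cases "z \<in> C") (auto simp: indicator_def abs_mult mult.commute)
    qed
  qed
qed

lemma has_weak_deriv_lincomb:
  assumes Q: "open Q" and u: "has_weak_deriv Q u es u'" and v: "has_weak_deriv Q v es v'"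
  shows "has_weak_deriv Q (\<lambda>z. \<alpha> * u z + \<beta> * v z) es (\<lambda>z. \<alpha> * u' z + \<beta> * v' z)"
proof -
  have L: "u \<in> Lp_loc 1 Q" "v \<in> Lp_loc 1 Q" "u' \<in> Lp_loc 1 Q" "v' \<in> Lp_loc 1 Q"
    using u v by (auto simp: has_weak_deriv_def)
  have lin: "(LINT z:Q|lebesgue. (\<alpha> * p z + \<beta> * q z) * \<phi> z) =
      \<alpha> * (LINT z:Q|lebesgue. p z * \<phi> z) + \<beta> * (LINT z:Q|lebesgue. q z * \<phi> z)"
    if "p \<in> Lp_loc 1 Q" "q \<in> Lp_loc 1 Q" "test_function Q \<phi>" for p q \<phi>
  proof -
    have "set_integrable lebesgue Q (\<lambda>z. p z * \<phi> z)" "set_integrable lebesgue Q (\<lambda>z. q z * \<phi> z)"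
      using set_integrable_Lp_loc_1_mult_test_function[OF Q] that by auto
    then have "(LINT z:Q|lebesgue. \<alpha> * (p z * \<phi> z) + \<beta> * (q z * \<phi> z)) =
        (LINT z:Q|lebesgue. \<alpha> * (p z * \<phi> z)) + (LINT z:Q|lebesgue. \<beta> * (q z * \<phi> z))"
      by (intro set_integral_add) auto
    then show ?thesis
      by (simp add: algebra_simps)
  qed
  show ?thesis
    unfolding has_weak_deriv_def
  proof (intro conjI allI impI)
    fix \<phi> assume \<phi>: "test_function Q \<phi>"
    have "(LINT z:Q|lebesgue. u z * iterated_deriv es \<phi> z) =
        (-1) ^ length es * (LINT z:Q|lebesgue. u' z * \<phi> z)"
      "(LINT z:Q|lebesgue. v z * iterated_deriv es \<phi> z) =
        (-1) ^ length es * (LINT z:Q|lebesgue. v' z * \<phi> z)"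
      using u v \<phi> by (auto simp: has_weak_deriv_def)
    then show "(LINT z:Q|lebesgue. (\<alpha> * u z + \<beta> * v z) * iterated_deriv es \<phi> z) =
        (-1) ^ length es * (LINT z:Q|lebesgue. (\<alpha> * u' z + \<beta> * v' z) * \<phi> z)"
      using lin[OF L(1,2) test_function_iterated_deriv[OF \<phi>, of es]] lin[OF L(3,4) \<phi>]
      by (simp add: algebra_simps)
  qed (use L in \<open>simp_all only: Lp_loc_1_lincomb\<close>)
qed

lemma const_in_Lp_loc:
  "(\<lambda>_. k) \<in> Lp_loc p Q"
proof -
  have "set_integrable lebesgue C (\<lambda>_. \<bar>k\<bar> ^ p)" if "compact C" for C :: "'a set"
    unfolding set_integrable_def scaleR_conv_of_real of_real_eq_id id_apply
    using that emeasure_compact_finite[of C]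
    by (intro integrable_mult_left integrable_real_indicator)
      (auto simp: fmeasurableD lmeasurable_compact borel_compact)
  then show ?thesis
    by (auto simp: Lp_loc_def)
qed

lemma has_weak_deriv_const:
  assumes "es \<noteq> []"
  shows "has_weak_deriv Q (\<lambda>_. k) es (\<lambda>_. 0)"
  using integral_iterated_deriv_eq_0[OF _ assms]
  by (auto simp: has_weak_deriv_def const_in_Lp_loc)

lemma is_parabolic_op_const:
  "is_parabolic_op Q a b c (\<lambda>_. k) (\<lambda>z. c z * k)"
  unfolding is_parabolic_op_def
  by (rule exI[of _ "\<lambda>_. 0"], rule exI[of _ "\<lambda>_. 0"], rule exI[of _ "\<lambda>_. 0"])
    (simp add: has_weak_deriv_const trace_def)

lemma is_parabolic_op_lincomb:
  assumes Q: "open Q" and u: "is_parabolic_op Q a b c u h" and v: "is_parabolic_op Q a b c v k"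
  shows "is_parabolic_op Q a b c (\<lambda>z. \<alpha> * u z + \<beta> * v z) (\<lambda>z. \<alpha> * h z + \<beta> * k z)"
proof -
  obtain ut Du D2u where U:
    "has_weak_deriv Q u [dir_t] ut"
    "\<And>i. has_weak_deriv Q u [dir_x i] (\<lambda>z. Du z $ i)"
    "\<And>i j. has_weak_deriv Q u [dir_x i, dir_x j] (\<lambda>z. D2u z $ i $ j)"
    "h = (\<lambda>z. - ut z - trace (a z ** D2u z) - b z \<bullet> Du z + c z * u z)"
    using u unfolding is_parabolic_op_def by (elim exE conjE) (rule that; simp)
  obtain vt Dv D2v where V:
    "has_weak_deriv Q v [dir_t] vt"
    "\<And>i. has_weak_deriv Q v [dir_x i] (\<lambda>z. Dv z $ i)"
    "\<And>i j. has_weak_deriv Q v [dir_x i, dir_x j] (\<lambda>z. D2v z $ i $ j)"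
    "k = (\<lambda>z. - vt z - trace (a z ** D2v z) - b z \<bullet> Dv z + c z * v z)"
    using v unfolding is_parabolic_op_def by (elim exE conjE) (rule that; simp)
  have tr: "trace (A ** (\<alpha> *\<^sub>R M + \<beta> *\<^sub>R N)) = \<alpha> * trace (A ** M) + \<beta> * trace (A ** N)"
    for A M N :: "real^'a^'a"
    by (simp add: trace_def matrix_matrix_mult_def sum.distrib sum_distrib_left distrib_left
        mult.left_commute)
  show ?thesis
    unfolding is_parabolic_op_def
  proof (intro exI conjI allI)
    show "has_weak_deriv Q (\<lambda>z. \<alpha> * u z + \<beta> * v z) [dir_t] (\<lambda>z. \<alpha> * ut z + \<beta> * vt z)"
      by (rule has_weak_deriv_lincomb[OF Q U(1) V(1)])
    show "has_weak_deriv Q (\<lambda>z. \<alpha> * u z + \<beta> * v z) [dir_x i]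
        (\<lambda>z. (\<alpha> *\<^sub>R Du z + \<beta> *\<^sub>R Dv z) $ i)" for i
      using has_weak_deriv_lincomb[OF Q U(2) V(2)] by simp
    show "has_weak_deriv Q (\<lambda>z. \<alpha> * u z + \<beta> * v z) [dir_x i, dir_x j]
        (\<lambda>z. (\<alpha> *\<^sub>R D2u z + \<beta> *\<^sub>R D2v z) $ i $ j)" for i j
      using has_weak_deriv_lincomb[OF Q U(3) V(3)] by simp
    show "(\<lambda>z. \<alpha> * h z + \<beta> * k z) = (\<lambda>z. - (\<alpha> * ut z + \<beta> * vt z)
        - trace (a z ** (\<alpha> *\<^sub>R D2u z + \<beta> *\<^sub>R D2v z)) - b z \<bullet> (\<alpha> *\<^sub>R Du z + \<beta> *\<^sub>R Dv z)
        + c z * (\<alpha> * u z + \<beta> * v z))"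
      unfolding U(4) V(4) by (rule ext) (simp add: tr inner_add_right algebra_simps)
  qed
qed

section \<open>Comparison of subsolutions and supersolutions\<close>

text \<open>The set \<open>U = {w > 0}\<close> is open. A point of its parabolic boundary lies in \<open>Q\<close>, where \<open>w = 0\<close>
  by continuity, or on the parabolic boundary of \<open>Q\<close>, hence on \<open>T\<close> or on \<open>\<Gamma>\<close>. So the maximum
  principle on \<open>U\<close> gives \<open>w \<le> 0\<close> on \<open>U\<close>, that is, \<open>U\<close> is empty.\<close>

lemma nonpos_if_Lw_nonpos_where_pos:
  fixes Q T \<Gamma> :: "(real \<times> (real^'n)) set"
  assumes Q: "open Q"
    and wmp: "\<forall>U. open U \<and> U \<subseteq> Q \<longrightarrow> weak_max_principle Q a b c K T U"
    and \<Gamma>: "\<Gamma> = parabolic_boundary Q - T"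
    and w: "w \<in> K"
    and h: "is_parabolic_op Q a b c w h"
    and h_le: "AE z in lebesgue_on Q. w z > 0 \<longrightarrow> h z \<le> 0"
    and w'_cont: "continuous_on (Q \<union> \<Gamma>) w'"
    and w'_eq: "\<And>z. z \<in> Q \<Longrightarrow> w' z = w z"
    and w'_le: "\<And>z. z \<in> \<Gamma> \<Longrightarrow> w' z \<le> 0"
    and z: "z \<in> Q"
  shows "w z \<le> 0"
proof -
  define U where "U = {z \<in> Q. w z > 0}"
  have UQ: "U \<subseteq> Q"
    by (auto simp: U_def)
  have "continuous_on Q w"
    using continuous_on_subset[OF w'_cont, of Q] w'_eq by (simp cong: continuous_on_cong)
  then have "open U"
    using continuous_open_preimage[OF _ Q, of w "{0<..}"] by (simp add: U_def vimage_def Int_def)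
  have "AE z in lebesgue_on U. h z \<le> 0"
    using h_le Q \<open>open U\<close> by (auto simp: AE_restrict_space_iff U_def elim!: AE_mp)
  moreover have "Limsup (at y within U) (\<lambda>x. ereal (w x)) \<le> 0"
    if y: "y \<in> parabolic_boundary U - T" for y
  proof -
    have y_front: "y \<in> frontier U"
      using y by (simp add: parabolic_boundary_def)
    then have "y \<notin> U"
      using \<open>open U\<close> by (simp add: frontier_def interior_open)
    have "y \<in> Q \<union> \<Gamma> \<and> w' y \<le> 0"
    proof (cases "y \<in> Q")
      case True
      with \<open>y \<notin> U\<close> show ?thesis
        by (auto simp: U_def w'_eq)
    next
      case False
      then have "y \<in> frontier Q"
        using y_front closure_mono[OF UQ] Q by (auto simp: frontier_def interior_open)
      then have "y \<in> parabolic_boundary Q"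
        using y UQ unfolding parabolic_boundary_def by blast
      with y show ?thesis
        by (auto simp: \<Gamma> w'_le)
    qed
    then have lim': "(w' \<longlongrightarrow> w' y) (at y within U)" and le: "w' y \<le> 0"
      using w'_cont UQ by (auto simp: continuous_on_def intro: tendsto_within_subset)
    have lim: "(w \<longlongrightarrow> w' y) (at y within U)"
      by (rule Lim_transform_within[OF lim' zero_less_one]) (use UQ w'_eq in auto)
    have "\<not> trivial_limit (at y within U)"
      using y_front \<open>y \<notin> U\<close> by (auto simp: frontier_def closure_def trivial_limit_within)
    then have "Limsup (at y within U) (\<lambda>x. ereal (w x)) = ereal (w' y)"
      using lim by (intro lim_imp_Limsup) auto
    with le show ?thesis
      by simp
  qed
  ultimately have "\<forall>z\<in>U. w z \<le> 0"
    using wmp \<open>open U\<close> UQ w h unfolding weak_max_principle_def by blast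
  then show ?thesis
    using z unfolding U_def by (metis (mono_tags, lifting) linorder_not_le mem_Collect_eq)
qed

text \<open>The condition is \<open>L u \<le> f\<close> almost everywhere on \<open>{u > \<psi>}\<close>. It says nothing where \<open>u \<le> \<psi>\<close>,
  so that \<open>0\<close> is a subsolution for zero data and any obstacle.\<close>

definition obstacle_subsolution ::
    "(real \<times> (real^'n)) set \<Rightarrow> (real \<times> (real^'n)) set \<Rightarrow> (real \<times> (real^'n) \<Rightarrow> real^'n^'n) \<Rightarrow>
     (real \<times> (real^'n) \<Rightarrow> real^'n) \<Rightarrow> (real \<times> (real^'n) \<Rightarrow> real) \<Rightarrow>
     (real \<times> (real^'n) \<Rightarrow> real) \<Rightarrow> (real \<times> (real^'n) \<Rightarrow> real) \<Rightarrow>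
     (real \<times> (real^'n) \<Rightarrow> real) \<Rightarrow> (real \<times> (real^'n) \<Rightarrow> real) \<Rightarrow> bool" where
  "obstacle_subsolution Q \<Gamma> a b c f g \<psi> u \<longleftrightarrow>
     (\<exists>u'. continuous_on (Q \<union> \<Gamma>) u' \<and> (\<forall>z\<in>Q. u' z = u z) \<and> (\<forall>z\<in>\<Gamma>. u' z \<le> g z)) \<and>
     (\<exists>h. is_parabolic_op Q a b c u h \<and>
        (AE z in lebesgue_on Q. min (h z - f z) (u z - \<psi> z) \<le> 0))"

lemma obstacle_solution_imp_subsolution:
  "obstacle_solution Q \<Gamma> a b c f g \<psi> u \<Longrightarrow> obstacle_subsolution Q \<Gamma> a b c f g \<psi> u"
  unfolding obstacle_solution_def obstacle_subsolution_def
  by (elim conjE exE, intro conjI exI) (auto elim: eventually_mono)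

lemma obstacle_solution_imp_supersolution:
  "obstacle_solution Q \<Gamma> a b c f g \<psi> u \<Longrightarrow> obstacle_supersolution Q \<Gamma> a b c f g \<psi> u"
  unfolding obstacle_solution_def obstacle_supersolution_def
  by (elim conjE exE, intro conjI exI) (auto elim: eventually_mono)

lemma convex_cone_lincomb:
  assumes "convex_cone_fun K" and "u \<in> K" and "v \<in> K" and "\<alpha> \<ge> 0" and "\<beta> \<ge> 0"
  shows "(\<lambda>z. \<alpha> * u z + \<beta> * v z) \<in> K"
  using assms unfolding convex_cone_fun_def by blast

text \<open>Where \<open>u > v + m\<close>, also \<open>u > \<psi>\<^sub>1 + m \<ge> \<psi>\<^sub>2\<close> since \<open>v \<ge> \<psi>\<^sub>1\<close>, so that the obstacle is inactive for \<open>u\<close> and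
  \<open>L (u - v - m) \<le> f\<^sub>2 - f\<^sub>1 - c m \<le> 0\<close>. On \<open>\<Gamma>\<close>, \<open>u - v - m \<le> g\<^sub>2 - g\<^sub>1 - m \<le> 0\<close>.
  Subtracting \<open>m > 0\<close> within the cone takes the constant \<open>-1\<close>.\<close>

lemma obstacle_comparison:
  fixes Q T \<Gamma> :: "(real \<times> (real^'n)) set"
  assumes Q: "open Q"
    and K: "convex_cone_fun K"
    and wmp: "\<forall>U. open U \<and> U \<subseteq> Q \<longrightarrow> weak_max_principle Q a b c K T U"
    and \<Gamma>: "\<Gamma> = parabolic_boundary Q - T"
    and u: "u \<in> K" "obstacle_subsolution Q \<Gamma> a b c f2 g2 \<psi>2 u"
    and v: "v \<in> neg_cone K" "obstacle_supersolution Q \<Gamma> a b c f1 g1 \<psi>1 v"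
    and m: "m \<ge> 0" "m = 0 \<or> (\<lambda>_. -1) \<in> K"
    and f: "AE z in lebesgue_on Q. f2 z \<le> f1 z + c z * m"
    and \<psi>: "\<And>z. z \<in> Q \<Longrightarrow> \<psi>2 z \<le> \<psi>1 z + m"
    and g: "\<And>z. z \<in> \<Gamma> \<Longrightarrow> g2 z \<le> g1 z + m"
    and z: "z \<in> Q"
  shows "u z \<le> v z + m"
proof -
  obtain u' hu where u': "continuous_on (Q \<union> \<Gamma>) u'" "\<And>z. z \<in> Q \<Longrightarrow> u' z = u z"
      "\<And>z. z \<in> \<Gamma> \<Longrightarrow> u' z \<le> g2 z"
    and hu: "is_parabolic_op Q a b c u hu"
      "AE z in lebesgue_on Q. min (hu z - f2 z) (u z - \<psi>2 z) \<le> 0"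
    using u(2) unfolding obstacle_subsolution_def by blast
  obtain v' hv where v': "continuous_on (Q \<union> \<Gamma>) v'" "\<And>z. z \<in> Q \<Longrightarrow> v' z = v z"
      "\<And>z. z \<in> \<Gamma> \<Longrightarrow> v' z \<ge> g1 z"
    and hv: "is_parabolic_op Q a b c v hv"
      "AE z in lebesgue_on Q. min (hv z - f1 z) (v z - \<psi>1 z) \<ge> 0"
    using v(2) unfolding obstacle_supersolution_def by blast
  have op: "is_parabolic_op Q a b c (\<lambda>z. u z - v z - m) (\<lambda>z. hu z - hv z - c z * m)"
    using is_parabolic_op_lincomb[OF Q is_parabolic_op_lincomb[OF Q hu(1) hv(1), of 1 "-1"]
        is_parabolic_op_const, of 1 1 "- m"]
    by simp
  have "(\<lambda>z. u z - v z) \<in> K"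
    using convex_cone_lincomb[OF K u(1), of "\<lambda>z. - v z" 1 1] v(1) by (simp add: neg_cone_def)
  then have "(\<lambda>z. u z - v z - m) \<in> K"
    using convex_cone_lincomb[OF K, of "\<lambda>z. u z - v z" "\<lambda>_. -1" 1 m] m by auto
  then have "u z - v z - m \<le> 0"
  proof (rule nonpos_if_Lw_nonpos_where_pos[OF Q wmp \<Gamma> _ op _ _ _ _ z])
    have "AE z in lebesgue_on Q. z \<in> Q"
      using AE_space[of "lebesgue_on Q"] by simp
    with hu(2) hv(2) f
    show "AE z in lebesgue_on Q. 0 < u z - v z - m \<longrightarrow> hu z - hv z - c z * m \<le> 0"
      by eventually_elim (use \<psi> in \<open>fastforce simp: min_le_iff_disj\<close>)
    show "continuous_on (Q \<union> \<Gamma>) (\<lambda>z. u' z - v' z - m)"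
      by (intro continuous_intros u' v')
    show "u' z - v' z - m \<le> 0" if "z \<in> \<Gamma>" for z
      using u'(3)[OF that] v'(3)[OF that] g[OF that] by simp
  qed (auto simp: u'(2) v'(2))
  then show ?thesis
    by simp
qed

lemma obstacle_subsolution_0:
  "obstacle_subsolution Q \<Gamma> a b c (\<lambda>_. 0) (\<lambda>_. 0) \<psi> (\<lambda>_. 0)"
  unfolding obstacle_subsolution_def
  by (auto intro!: exI[of _ "\<lambda>_. 0"] is_parabolic_op_const[where k = 0, simplified])

lemma obstacle_supersolution_0:
  assumes "(\<lambda>_. 0) \<in> W2_loc (CARD('n) + 1) Q"
  shows "obstacle_supersolution Q \<Gamma> a b (c :: real \<times> (real^'n) \<Rightarrow> real)
    (\<lambda>_. 0) (\<lambda>_. 0) (\<lambda>_. 0) (\<lambda>_. 0)"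
  using assms unfolding obstacle_supersolution_def
  by (auto intro!: exI[of _ "\<lambda>_. 0"] is_parabolic_op_const[where k = 0, simplified])

section \<open>The bounds\<close>

lemma AE_le_mult_if_ess_sup_le:
  assumes "ereal (1 / c0) * ess_sup_on Q f \<le> ereal m" and "c0 > 0"
  shows "AE z in lebesgue_on Q. f z \<le> c0 * m"
proof -
  have le: "ess_sup_on Q f \<le> ereal (c0 * m)"
    using assms by (cases "ess_sup_on Q f") (auto simp: field_simps)
  from esssup_AE[of "\<lambda>z. ereal (f z)" "lebesgue_on Q"] show ?thesis
  proof eventually_elim
    case (elim z)
    then have "ereal (f z) \<le> ereal (c0 * m)"
      using le by (rule order_trans)
    then show ?case
      by simp
  qed
qed

lemma AE_ge_mult_if_ess_inf_ge:
  assumes "ereal (- m) \<le> ereal (1 / c0) * ess_inf_on Q f" and "c0 > 0"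
  shows "AE z in lebesgue_on Q. - (c0 * m) \<le> f z"
proof -
  have "ereal (1 / c0) * ess_sup_on Q (\<lambda>z. - f z) \<le> ereal m"
    using assms by (cases "ess_sup_on Q (\<lambda>z. - f z)") auto
  from AE_le_mult_if_ess_sup_le[OF this assms(2)] show ?thesis
    by eventually_elim auto
qed

lemma ereal_le_if_nonneg:
  assumes "0 \<le> M" and "\<And>m. 0 \<le> m \<Longrightarrow> M = ereal m \<Longrightarrow> x \<le> m"
  shows "ereal x \<le> M"
  using assms by (cases M) auto

lemma ereal_ge_if_nonpos:
  assumes "M \<le> 0" and "\<And>m. 0 \<le> m \<Longrightarrow> M = ereal (- m) \<Longrightarrow> - m \<le> x"
  shows "M \<le> ereal x"
  using assms(1) assms(2)[of "- real_of_ereal M"] by (cases M) auto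

theorem proposition3p3:
  fixes Q S \<Gamma> :: "(real \<times> (real^'n)) set"
    and a :: "real \<times> (real^'n) \<Rightarrow> real^'n^'n"
    and b :: "real \<times> (real^'n) \<Rightarrow> real^'n"
    and c :: "real \<times> (real^'n) \<Rightarrow> real"
    and K :: "(real \<times> (real^'n) \<Rightarrow> real) set"
  assumes Q: "open Q"
    and K_sub: "K \<subseteq> W2_loc (CARD('n) + 1) Q"
    and K_cone: "convex_cone_fun K"
    and K_one: "(\<lambda>_. 1) \<in> K"
    and S: "S \<subset> parabolic_boundary Q"
    and S_open: "openin (top_of_set (parabolic_boundary Q)) S"
    and a_meas: "a \<in> borel_measurable (lebesgue_on Q)"
    and a_nonneg: "AE z in lebesgue_on Q. transpose (a z) = a z \<and> (\<forall>\<xi>. \<xi> \<bullet> (a z *v \<xi>) \<ge> 0)"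
    and b_meas: "b \<in> borel_measurable (lebesgue_on Q)"
    and c_meas: "c \<in> borel_measurable (lebesgue_on Q)"
    and c_nonneg: "AE z in lebesgue_on Q. c z \<ge> 0"
    and wmp: "\<And>U. open U \<Longrightarrow> U \<subseteq> Q \<Longrightarrow>
          weak_max_principle Q a b c K (top_of_set (frontier Q) closure_of S) U"
    and \<Gamma>: "\<Gamma> = parabolic_boundary Q - (top_of_set (frontier Q) closure_of S)"
  shows
    "((\<lambda>_. -1) \<in> K \<longrightarrow>
       \<comment> \<open>(1), (2)\<close>
       (\<forall>f g \<psi> v. obstacle_data Q \<Gamma> f g \<psi> \<and> v \<in> neg_cone K \<and>
            obstacle_supersolution Q \<Gamma> a b c f g \<psi> v \<longrightarrow>
          ((AE z in lebesgue_on Q. f z \<ge> 0) \<longrightarrow>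
             (\<forall>z\<in>Q. ereal (v z) \<ge> min 0 (INF y\<in>\<Gamma>. ereal (g y)))) \<and>
          (\<forall>c0>0. (AE z in lebesgue_on Q. c z \<ge> c0) \<longrightarrow>
             (\<forall>z\<in>Q. ereal (v z) \<ge>
                min 0 (min (ereal (1 / c0) * ess_inf_on Q f) (INF y\<in>\<Gamma>. ereal (g y)))))) \<and>
       \<comment> \<open>(3), (4)\<close>
       (\<forall>f g \<psi> u. obstacle_data Q \<Gamma> f g \<psi> \<and> u \<in> K \<inter> neg_cone K \<and>
            obstacle_solution Q \<Gamma> a b c f g \<psi> u \<longrightarrow>
          ((AE z in lebesgue_on Q. f z \<le> 0) \<longrightarrow>
             (\<forall>z\<in>Q. ereal (u z) \<le>
                max 0 (max (SUP y\<in>\<Gamma>. ereal (g y)) (SUP y\<in>Q. ereal (\<psi> y))))) \<and>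
          (\<forall>c0>0. (AE z in lebesgue_on Q. c z \<ge> c0) \<longrightarrow>
             (\<forall>z\<in>Q. ereal (u z) \<le>
                max 0 (max (ereal (1 / c0) * ess_sup_on Q f)
                  (max (SUP y\<in>\<Gamma>. ereal (g y)) (SUP y\<in>Q. ereal (\<psi> y))))))))
     \<and>
     \<comment> \<open>(5)\<close>
     (\<forall>f1 g1 \<psi>1 u1 f2 g2 \<psi>2 u2.
        obstacle_data Q \<Gamma> f1 g1 \<psi>1 \<and> u1 \<in> K \<inter> neg_cone K \<and>
        obstacle_solution Q \<Gamma> a b c f1 g1 \<psi>1 u1 \<and>
        obstacle_data Q \<Gamma> f2 g2 \<psi>2 \<and> u2 \<in> K \<inter> neg_cone K \<and>
        obstacle_solution Q \<Gamma> a b c f2 g2 \<psi>2 u2 \<and>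
        (AE z in lebesgue_on Q. f1 z \<ge> f2 z) \<and> (\<forall>z\<in>Q. \<psi>1 z \<ge> \<psi>2 z) \<and> (\<forall>z\<in>\<Gamma>. g1 z \<ge> g2 z)
        \<longrightarrow> (\<forall>z\<in>Q. u1 z \<ge> u2 z))
     \<and>
     \<comment> \<open>(6)\<close>
     ((\<lambda>_. -1) \<in> K \<longrightarrow>
       (\<forall>f1 g1 \<psi>1 u1 f2 g2 \<psi>2 u2.
          obstacle_data Q \<Gamma> f1 g1 \<psi>1 \<and> u1 \<in> K \<inter> neg_cone K \<and>
          obstacle_solution Q \<Gamma> a b c f1 g1 \<psi>1 u1 \<and>
          obstacle_data Q \<Gamma> f2 g2 \<psi>2 \<and> u2 \<in> K \<inter> neg_cone K \<and>
          obstacle_solution Q \<Gamma> a b c f2 g2 \<psi>2 u2 \<longrightarrow>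
            (\<forall>c0>0. (AE z in lebesgue_on Q. c z \<ge> c0) \<longrightarrow>
               (\<forall>z\<in>Q. ereal \<bar>u1 z - u2 z\<bar> \<le>
                  max (ereal (1 / c0) * ess_sup_on Q (\<lambda>y. \<bar>f1 y - f2 y\<bar>))
                    (max (SUP y\<in>\<Gamma>. ereal \<bar>g1 y - g2 y\<bar>) (SUP y\<in>Q. ereal \<bar>\<psi>1 y - \<psi>2 y\<bar>)))) \<and>
            ((AE z in lebesgue_on Q. f1 z = f2 z) \<longrightarrow>
               (\<forall>z\<in>Q. ereal \<bar>u1 z - u2 z\<bar> \<le>
                  max (SUP y\<in>\<Gamma>. ereal \<bar>g1 y - g2 y\<bar>) (SUP y\<in>Q. ereal \<bar>\<psi>1 y - \<psi>2 y\<bar>)))))"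
proof -
  let ?T = "top_of_set (frontier Q) closure_of S"
  have "\<forall>U. open U \<and> U \<subseteq> Q \<longrightarrow> weak_max_principle Q a b c K ?T U"
    using wmp by blast
  note compare = obstacle_comparison[OF Q K_cone this \<Gamma>]
  have K_zero: "(\<lambda>_. 0) \<in> K" "(\<lambda>_. 0) \<in> neg_cone K"
    using convex_cone_lincomb[OF K_cone K_one K_one, of 0 0] by (auto simp: neg_cone_def)
  have zero_super: "obstacle_supersolution Q \<Gamma> a b c (\<lambda>_. 0) (\<lambda>_. 0) (\<lambda>_. 0) (\<lambda>_. 0)"
    using K_zero(1) K_sub by (intro obstacle_supersolution_0) auto
  have c_mult: "AE z in lebesgue_on Q. c0 * m \<le> c z * m"
    if "AE z in lebesgue_on Q. c z \<ge> c0" "m \<ge> 0" for c0 m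
    using that(1) by eventually_elim (use that(2) in \<open>simp add: mult_right_mono\<close>)
  \<comment> \<open>With \<open>u = 0\<close> in the comparison any obstacle for \<open>0\<close> will do; taking that of \<open>v\<close> makes the
    condition on the obstacles trivial.\<close>
  have lower: "- m \<le> v z"
    if "(\<lambda>_. -1) \<in> K" "v \<in> neg_cone K" "obstacle_supersolution Q \<Gamma> a b c f g \<psi> v" "m \<ge> 0"
      "AE z in lebesgue_on Q. - (c z * m) \<le> f z" "ereal (- m) \<le> (INF y\<in>\<Gamma>. ereal (g y))" "z \<in> Q"
    for f g \<psi> v m z
  proof -
    have "0 \<le> v z + m"
    proof (rule compare[OF K_zero(1) obstacle_subsolution_0[where \<psi> = \<psi>] that(2,3,4) _ _ _ _ that(7)])
      show "AE z in lebesgue_on Q. 0 \<le> f z + c z * m"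
        using that(5) by eventually_elim simp
      show "0 \<le> g y + m" if "y \<in> \<Gamma>" for y
        using \<open>ereal (- m) \<le> _\<close> that by (auto simp: le_INF_iff)
    qed (use that in auto)
    then show ?thesis
      by simp
  qed
  have upper: "u z \<le> m"
    if "(\<lambda>_. -1) \<in> K" "u \<in> K" "obstacle_solution Q \<Gamma> a b c f g \<psi> u" "m \<ge> 0"
      "AE z in lebesgue_on Q. f z \<le> c z * m"
      "(SUP y\<in>\<Gamma>. ereal (g y)) \<le> ereal m" "(SUP y\<in>Q. ereal (\<psi> y)) \<le> ereal m" "z \<in> Q"
    for f g \<psi> u m z
    using compare[OF that(2) obstacle_solution_imp_subsolution[OF that(3)] K_zero(2) zero_super that(4)
        _ _ _ _ that(8)] that
    by (auto simp: SUP_le_iff)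
  have diff: "\<bar>u1 z - u2 z\<bar> \<le> m"
    if "(\<lambda>_. -1) \<in> K" "u1 \<in> K \<inter> neg_cone K" "u2 \<in> K \<inter> neg_cone K"
      "obstacle_solution Q \<Gamma> a b c f1 g1 \<psi>1 u1" "obstacle_solution Q \<Gamma> a b c f2 g2 \<psi>2 u2" "m \<ge> 0"
      "AE z in lebesgue_on Q. \<bar>f1 z - f2 z\<bar> \<le> c z * m"
      "(SUP y\<in>\<Gamma>. ereal \<bar>g1 y - g2 y\<bar>) \<le> ereal m"
      "(SUP y\<in>Q. ereal \<bar>\<psi>1 y - \<psi>2 y\<bar>) \<le> ereal m" "z \<in> Q"
    for f1 g1 \<psi>1 u1 f2 g2 \<psi>2 u2 m z
  proof -
    have f: "AE z in lebesgue_on Q. f1 z \<le> f2 z + c z * m"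
        "AE z in lebesgue_on Q. f2 z \<le> f1 z + c z * m"
      using that(7) by (auto elim!: AE_mp)
    have g: "g1 y \<le> g2 y + m" "g2 y \<le> g1 y + m" if "y \<in> \<Gamma>" for y
      using \<open>(SUP y\<in>\<Gamma>. _ y) \<le> _\<close> that by (force simp: SUP_le_iff)+
    have \<psi>: "\<psi>1 y \<le> \<psi>2 y + m" "\<psi>2 y \<le> \<psi>1 y + m" if "y \<in> Q" for y
      using \<open>(SUP y\<in>Q. _ y) \<le> _\<close> that by (force simp: SUP_le_iff)+
    have "u1 z \<le> u2 z + m"
      by (rule compare[of u1 f1 g1 \<psi>1 u2 f2 g2 \<psi>2])
        (use that f g \<psi> in \<open>auto intro: obstacle_solution_imp_subsolution
            obstacle_solution_imp_supersolution\<close>)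
    moreover have "u2 z \<le> u1 z + m"
      by (rule compare[of u2 f2 g2 \<psi>2 u1 f1 g1 \<psi>1])
        (use that f g \<psi> in \<open>auto intro: obstacle_solution_imp_subsolution
            obstacle_solution_imp_supersolution\<close>)
    ultimately show ?thesis
      by simp
  qed
  show ?thesis
  proof (intro conjI allI impI ballI; (elim conjE)?)
    fix f g \<psi> v z
    assume A: "(\<lambda>_. -1) \<in> K" "v \<in> neg_cone K" "obstacle_supersolution Q \<Gamma> a b c f g \<psi> v" "z \<in> Q"
    {
      assume "AE z in lebesgue_on Q. f z \<ge> 0"
      with c_nonneg have f: "AE z in lebesgue_on Q. - (c z * m) \<le> f z" if "m \<ge> 0" for m
        by eventually_elim (use that mult_nonneg_nonneg[OF _ \<open>m \<ge> 0\<close>] in \<open>smt (verit)\<close>)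
      show "min 0 (INF y\<in>\<Gamma>. ereal (g y)) \<le> ereal (v z)"
      proof (rule ereal_ge_if_nonpos)
        fix m :: real
        assume "0 \<le> m" and m: "min 0 (INF y\<in>\<Gamma>. ereal (g y)) = ereal (- m)"
        show "- m \<le> v z"
          by (rule lower[OF A(1-3) \<open>0 \<le> m\<close> f[OF \<open>0 \<le> m\<close>] _ A(4)]) (simp flip: m)
      qed simp
    }
    {
      fix c0 :: real
      let ?M = "min 0 (min (ereal (1 / c0) * ess_inf_on Q f) (INF y\<in>\<Gamma>. ereal (g y)))"
      assume c0: "c0 > 0" "AE z in lebesgue_on Q. c z \<ge> c0"
      show "?M \<le> ereal (v z)"
      proof (rule ereal_ge_if_nonpos)
        fix m :: real
        assume "0 \<le> m" and m: "?M = ereal (- m)"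
        have "AE z in lebesgue_on Q. - (c0 * m) \<le> f z"
          by (rule AE_ge_mult_if_ess_inf_ge[OF _ c0(1)]) (simp flip: m add: min_le_iff_disj)
        with c_mult[OF c0(2) \<open>0 \<le> m\<close>] have "AE z in lebesgue_on Q. - (c z * m) \<le> f z"
          by eventually_elim simp
        then show "- m \<le> v z"
          by (rule lower[OF A(1-3) \<open>0 \<le> m\<close> _ _ A(4)]) (simp flip: m add: min_le_iff_disj)
      qed simp
    }
  next
    fix f g \<psi> u z
    assume A: "(\<lambda>_. -1) \<in> K" "u \<in> K \<inter> neg_cone K" "obstacle_solution Q \<Gamma> a b c f g \<psi> u" "z \<in> Q"
    have "u \<in> K"
      using A(2) by simp
    {
      let ?M = "max 0 (max (SUP y\<in>\<Gamma>. ereal (g y)) (SUP y\<in>Q. ereal (\<psi> y)))"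
      assume "AE z in lebesgue_on Q. f z \<le> 0"
      with c_nonneg have f: "AE z in lebesgue_on Q. f z \<le> c z * m" if "m \<ge> 0" for m
        by eventually_elim (use that mult_nonneg_nonneg[OF _ \<open>m \<ge> 0\<close>] in \<open>smt (verit)\<close>)
      show "ereal (u z) \<le> ?M"
      proof (rule ereal_le_if_nonneg)
        fix m :: real
        assume "0 \<le> m" and m: "?M = ereal m"
        show "u z \<le> m"
          by (rule upper[OF A(1) \<open>u \<in> K\<close> A(3) \<open>0 \<le> m\<close> f[OF \<open>0 \<le> m\<close>] _ _ A(4)])
            (simp_all flip: m add: le_max_iff_disj)
      qed simp
    }
    {
      fix c0 :: real
      let ?M = "max 0 (max (ereal (1 / c0) * ess_sup_on Q f)
        (max (SUP y\<in>\<Gamma>. ereal (g y)) (SUP y\<in>Q. ereal (\<psi> y))))"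
      assume c0: "c0 > 0" "AE z in lebesgue_on Q. c z \<ge> c0"
      show "ereal (u z) \<le> ?M"
      proof (rule ereal_le_if_nonneg)
        fix m :: real
        assume "0 \<le> m" and m: "?M = ereal m"
        have "AE z in lebesgue_on Q. f z \<le> c0 * m"
          by (rule AE_le_mult_if_ess_sup_le[OF _ c0(1)]) (simp flip: m add: le_max_iff_disj)
        with c_mult[OF c0(2) \<open>0 \<le> m\<close>] have "AE z in lebesgue_on Q. f z \<le> c z * m"
          by eventually_elim simp
        then show "u z \<le> m"
          by (rule upper[OF A(1) \<open>u \<in> K\<close> A(3) \<open>0 \<le> m\<close> _ _ _ A(4)])
            (simp_all flip: m add: le_max_iff_disj)
      qed simp
    }
  next
    fix f1 g1 \<psi>1 u1 f2 g2 \<psi>2 u2 z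
    assume A: "u1 \<in> K \<inter> neg_cone K" "obstacle_solution Q \<Gamma> a b c f1 g1 \<psi>1 u1"
      "u2 \<in> K \<inter> neg_cone K" "obstacle_solution Q \<Gamma> a b c f2 g2 \<psi>2 u2"
      and le: "AE z in lebesgue_on Q. f2 z \<le> f1 z" "\<forall>z\<in>Q. \<psi>2 z \<le> \<psi>1 z" "\<forall>z\<in>\<Gamma>. g2 z \<le> g1 z"
      and z: "z \<in> Q"
    show "u2 z \<le> u1 z"
      using compare[of u2 f2 g2 \<psi>2 u1 f1 g1 \<psi>1 0 z] A le z
      by (auto intro: obstacle_solution_imp_subsolution obstacle_solution_imp_supersolution)
  next
    fix f1 g1 \<psi>1 u1 f2 g2 \<psi>2 u2 z
    assume A: "(\<lambda>_. -1) \<in> K" "u1 \<in> K \<inter> neg_cone K" "obstacle_solution Q \<Gamma> a b c f1 g1 \<psi>1 u1"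
      "u2 \<in> K \<inter> neg_cone K" "obstacle_solution Q \<Gamma> a b c f2 g2 \<psi>2 u2" and z: "z \<in> Q"
    \<comment> \<open>As \<open>Q\<close> is nonempty, the supremum over \<open>Q\<close> keeps the bound nonnegative; the supremum over
      \<open>\<Gamma>\<close> is \<open>-\<infinity>\<close> when \<open>\<Gamma>\<close> is empty.\<close>
    have nonneg: "0 \<le> (SUP y\<in>Q. ereal \<bar>\<psi>1 y - \<psi>2 y\<bar>)"
      by (rule SUP_upper2[OF z]) simp
    {
      fix c0 :: real
      let ?M = "max (ereal (1 / c0) * ess_sup_on Q (\<lambda>y. \<bar>f1 y - f2 y\<bar>))
        (max (SUP y\<in>\<Gamma>. ereal \<bar>g1 y - g2 y\<bar>) (SUP y\<in>Q. ereal \<bar>\<psi>1 y - \<psi>2 y\<bar>))"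
      assume c0: "c0 > 0" "AE z in lebesgue_on Q. c z \<ge> c0"
      show "ereal \<bar>u1 z - u2 z\<bar> \<le> ?M"
      proof (rule ereal_le_if_nonneg)
        fix m :: real
        assume "0 \<le> m" and m: "?M = ereal m"
        have "AE z in lebesgue_on Q. \<bar>f1 z - f2 z\<bar> \<le> c0 * m"
          by (rule AE_le_mult_if_ess_sup_le[OF _ c0(1)]) (simp flip: m add: le_max_iff_disj)
        with c_mult[OF c0(2) \<open>0 \<le> m\<close>] have "AE z in lebesgue_on Q. \<bar>f1 z - f2 z\<bar> \<le> c z * m"
          by eventually_elim simp
        then show "\<bar>u1 z - u2 z\<bar> \<le> m"
          by (rule diff[OF A(1,2,4,3,5) \<open>0 \<le> m\<close> _ _ _ z]) (simp_all flip: m add: le_max_iff_disj)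
      qed (use nonneg in \<open>simp add: le_max_iff_disj\<close>)
    }
    {
      let ?M = "max (SUP y\<in>\<Gamma>. ereal \<bar>g1 y - g2 y\<bar>) (SUP y\<in>Q. ereal \<bar>\<psi>1 y - \<psi>2 y\<bar>)"
      assume "AE z in lebesgue_on Q. f1 z = f2 z"
      with c_nonneg have f: "AE z in lebesgue_on Q. \<bar>f1 z - f2 z\<bar> \<le> c z * m" if "m \<ge> 0" for m
        by eventually_elim (use that in simp)
      show "ereal \<bar>u1 z - u2 z\<bar> \<le> ?M"
      proof (rule ereal_le_if_nonneg)
        fix m :: real
        assume "0 \<le> m" and m: "?M = ereal m"
        show "\<bar>u1 z - u2 z\<bar> \<le> m"
          by (rule diff[OF A(1,2,4,3,5) \<open>0 \<le> m\<close> f[OF \<open>0 \<le> m\<close>] _ _ z])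
            (simp_all flip: m add: le_max_iff_disj)
      qed (use nonneg in \<open>simp add: le_max_iff_disj\<close>)
    }
  qed
qed

end
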